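(* Let $\beta > 1$ be a real number. There exists an uncountable set $\mathcal{R}$ of real numbers such that, for every $r \in \mathcal{R}$, there are uncountably many real numbers $x \in [0,1)$ with $\widehat{r}_\beta(x) = 1$ and $r_\beta(x) = r$.
   Context: For a real number $\beta > 1$, the $\beta$-transformation $T_\beta$ on $[0,1)$ is defined by $T_\beta(x) = \beta x \bmod 1$ (that is, $T_\beta(x) = \beta x - \lfloor \beta x \rfloor$), and $T_\beta^n$ denotes its $n$-th iterate. For $x \in [0,1)$, set $$r_\beta(x) := \sup\{ r \ge 0 : |T_\beta^n x - x| < (\beta^n)^{-r} \text{ for infinitely many integers } n \ge 1\}$$ and $$\widehat{r}_\beta(x) := \sup\{ \widehat{r} \ge 0 : \text{for every sufficiently large integer } N, \text{ there exists an integer } n \text{ such that } 1 \le n \le N \text{ and } |T_\beta^n x - x| < (\beta^N)^{-\widehat{r}}\}.$$ Both quantities take values in $[0, +\infty]$. *)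

theory Defs
  imports "HOL-Analysis.Analysis"
begin

definition beta_transform :: "real \<Rightarrow> real \<Rightarrow> real" where
  "beta_transform \<beta> x = frac (\<beta> * x)"

text \<open>The suprema are taken in \<^typ>\<open>ereal\<close>, so that the value \<open>\<infinity>\<close> is possible. For
  \<open>x \<in> [0,1)\<close> the exponent 0 belongs to both sets, so neither supremum is over the empty set.\<close>

definition recurrence_exponent :: "real \<Rightarrow> real \<Rightarrow> ereal" where
  "recurrence_exponent \<beta> x =
     Sup (ereal ` {r. r \<ge> 0 \<and>
       infinite {n::nat. n \<ge> 1 \<and> \<bar>(beta_transform \<beta> ^^ n) x - x\<bar> < (\<beta> ^ n) powr (- r)}})"

definition uniform_recurrence_exponent :: "real \<Rightarrow> real \<Rightarrow> ereal" where
  "uniform_recurrence_exponent \<beta> x =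
     Sup (ereal ` {r. r \<ge> 0 \<and>
       (\<forall>\<^sub>F N::nat in sequentially. \<exists>n::nat. 1 \<le> n \<and> n \<le> N \<and>
          \<bar>(beta_transform \<beta> ^^ n) x - x\<bar> < (\<beta> ^ N) powr (- r))})"

end

theory Submission
  imports Defs "HOL-Library.Sublist" "HOL-Library.Nat_Bijection"
begin

text \<open>Infinite words over {0,1} whose ones are far apart are expansions in base \<open>\<beta>\<close> on which
  \<open>T\<^sub>\<beta>\<close> acts as the shift, so that \<open>\<bar>T\<^sub>\<beta>\<^sup>n x - x\<bar>\<close> is \<open>\<beta>\<close> to the minus the length of the
  longest common prefix of the word of \<open>x\<close> and its \<open>n\<close>-th shift, up to constants.
  Take the limit of the standard words
  \<open>s\<^sub>k\<^sub>+\<^sub>2 = s\<^sub>k\<^sub>+\<^sub>1\<close> (repeated \<open>a\<^sub>k\<close> times) followed by \<open>s\<^sub>k\<close>, and let \<open>q\<^sub>k\<close> be the length of \<open>s\<^sub>k\<close>.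
  Since \<open>s\<^sub>k\<close> and \<open>s\<^sub>k\<^sub>+\<^sub>1\<close> almost commute, the common prefix for the shift by \<open>q\<^sub>k\<close> has length at least
  \<open>q\<^sub>k\<^sub>+\<^sub>1 - 2\<close>; by the theorem of Fine and Wilf and \<open>gcd(q\<^sub>k, q\<^sub>k\<^sub>+\<^sub>1) = 1\<close>, no shift by
  \<open>n < q\<^sub>k\<^sub>+\<^sub>1\<close> does better than \<open>q\<^sub>k\<^sub>+\<^sub>1\<close>. Hence the uniform exponent is 1 and the other one is
  the upper limit of \<open>q\<^sub>k\<^sub>+\<^sub>1 / q\<^sub>k = [a\<^sub>k\<^sub>-\<^sub>1; a\<^sub>k\<^sub>-\<^sub>2, \<dots>]\<close>. The exponents consist of blocks
  \<open>d, c\<^sub>m, \<dots>, c\<^sub>1, 4\<close> of growing length with digits 2 and 3 otherwise; the upper limit is then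
  \<open>[4; c\<^sub>1, c\<^sub>2, \<dots>]\<close>, while the separators \<open>d\<close> are free.\<close>

section \<open>Exponents from return times\<close>

lemma Sup_exponents_eq:
  fixes r :: real
  assumes "0 < r" and "\<And>s. 0 \<le> s \<Longrightarrow> s < r \<Longrightarrow> P s" and "\<And>s. r < s \<Longrightarrow> \<not> P s"
  shows "Sup (ereal ` {s. s \<ge> 0 \<and> P s}) = ereal r"
proof (rule Sup_eqI)
  fix y assume "y \<in> ereal ` {s. s \<ge> 0 \<and> P s}"
  then show "y \<le> ereal r" using assms(3) by (force simp: not_less[symmetric])
next
  fix y assume y: "\<And>z. z \<in> ereal ` {s. s \<ge> 0 \<and> P s} \<Longrightarrow> z \<le> y"
  show "ereal r \<le> y"
  proof (rule dense_le)
    fix z assume z: "z < ereal r"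
    show "z \<le> y"
    proof (cases "z < 0")
      case True
      have "ereal 0 \<le> y" using assms by (intro y) auto
      then show ?thesis using True by (simp add: zero_ereal_def)
    next
      case False
      with z obtain s where "z = ereal s" "0 \<le> s" "s < r"
        by (cases z) (auto simp: not_less)
      then show ?thesis using assms(2) by (intro y) auto
    qed
  qed
qed

text \<open>Multiplicative constants are dominated by every positive power of
  \<open>\<beta> ^ n\<close>, so \<open>c\<close> and \<open>C\<close> below have no influence on
  the exponents.\<close>

lemma eventually_less_powr:
  fixes \<beta> e K :: real
  assumes "\<beta> > 1" "e > 0"
  shows "\<forall>\<^sub>F n::nat in sequentially. K < \<beta> powr (e * real n)"
proof -
  have "\<beta> powr e > 1" using assms by simp
  then obtain m where m: "K < (\<beta> powr e) ^ m" using real_arch_pow by blast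
  have "K < \<beta> powr (e * real n)" if "m \<le> n" for n
  proof -
    have "(\<beta> powr e) ^ m \<le> (\<beta> powr e) ^ n"
      using that \<open>\<beta> powr e > 1\<close> by (intro power_increasing) auto
    also have "\<dots> = \<beta> powr (e * real n)" using assms by (simp add: powr_realpow[symmetric] powr_powr)
    finally show ?thesis using m by simp
  qed
  then show ?thesis by (auto simp: eventually_sequentially)
qed

lemma strict_mono_bracket:
  fixes Q :: "nat \<Rightarrow> nat"
  assumes "strict_mono Q" "Q K \<le> n"
  obtains k where "K \<le> k" "Q k \<le> n" "n < Q (Suc k)"
proof -
  have "\<exists>m. n < Q m" using strict_mono_imp_increasing[OF assms(1), of "Suc n"] Suc_le_lessD by blast
  then have l: "n < Q (LEAST m. n < Q m)" by (rule LeastI_ex)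
  moreover have "Q 0 \<le> n"
    using strict_mono_mono[OF assms(1)] assms(2) by (meson le_trans monoD zero_le)
  ultimately obtain k where k: "(LEAST m. n < Q m) = Suc k"
    by (metis not_less not0_implies_Suc)
  have "\<not> n < Q k" using not_less_Least[of k "\<lambda>m. n < Q m"] k by simp
  moreover have "K \<le> k"
  proof -
    have "Q K < Q (Suc k)" using l k assms(2) by simp
    then show ?thesis using strict_mono_less[OF assms(1)] by simp
  qed
  ultimately show ?thesis using that l k by simp
qed

lemma powr_power_neg:
  fixes \<beta> :: real assumes "\<beta> > 0" shows "(\<beta> ^ n) powr (- s) = \<beta> powr (- (s * real n))"
  using assms by (simp add: powr_realpow[symmetric] powr_powr mult.commute)

lemma less_powr_neg_iff:
  fixes \<beta> :: real assumes "\<beta> > 0"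
  shows "C * \<beta> powr (- u) < \<beta> powr (- v) \<longleftrightarrow> C < \<beta> powr (u - v)"
  using assms by (simp add: powr_diff powr_minus field_simps)

text \<open>Up to constants, \<beta> to the minus \<open>Q (Suc k)\<close> is the best distance
  among all \<open>n < Q (Suc k)\<close>, and \<open>Q k\<close> attains it. A bound
  \<open>N\<close> from \<open>Q k\<close> up to \<open>Q (Suc k) - 1\<close> thus always permits
  exponents below 1, and at its last value nothing beyond 1. The single time \<open>Q k\<close> has
  exponent about \<open>Q (Suc k) / Q k\<close>, with upper limit \<open>r\<close>.\<close>

lemma exponents_of_return_times:
  fixes \<beta> x r c C :: real and Q :: "nat \<Rightarrow> nat"
  defines "D n \<equiv> \<bar>(beta_transform \<beta> ^^ n) x - x\<bar>"
  assumes \<beta>: "\<beta> > 1" and Q: "strict_mono Q" "0 < Q 0" and pos: "0 < C" "0 < c" "0 < r"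
    and close: "\<And>k. D (Q k) \<le> C * \<beta> powr (- real (Q (Suc k)))"
    and far: "\<And>k n. 1 \<le> n \<Longrightarrow> n < Q (Suc k) \<Longrightarrow> c * \<beta> powr (- real (Q (Suc k))) \<le> D n"
    and upper: "\<And>s. r < s \<Longrightarrow> \<forall>\<^sub>F k in sequentially. real (Q (Suc k)) \<le> s * real (Q k)"
    and lower: "\<And>s. s < r \<Longrightarrow> \<exists>\<^sub>F k in sequentially. s * real (Q k) \<le> real (Q (Suc k))"
  shows "uniform_recurrence_exponent \<beta> x = 1" "recurrence_exponent \<beta> x = ereal r"
proof -
  have \<beta>0: "\<beta> > 0" using \<beta> by simp
  have Qpos: "0 < Q k" for k
    using Q by (metis bot_nat_0.not_eq_extremum not_less_zero strict_mono_less)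
  have mono: "\<beta> powr u \<le> \<beta> powr v" if "u \<le> v" for u v
    using that \<beta> by (simp add: powr_mono)
  have small: "\<forall>\<^sub>F n::nat in sequentially. C * \<beta> powr (- (t * real n)) < \<beta> powr (- (s * real n))"
    if "s < t" for s t
    using eventually_less_powr[OF \<beta>, of "t - s" C] that
    by (simp add: less_powr_neg_iff[OF \<beta>0] left_diff_distrib)
  have large: "\<forall>\<^sub>F n::nat in sequentially. \<beta> powr (- (s * real n)) < c * \<beta> powr (- (t * real n))"
    if "t < s" for s t
  proof -
    have "\<beta> powr (- u) < c * \<beta> powr (- v) \<longleftrightarrow> 1 / c < \<beta> powr (u - v)" for u v
      using less_powr_neg_iff[OF \<beta>0, of "1 / c" u v] pos by (simp add: field_simps)
    then show ?thesis
      using eventually_less_powr[OF \<beta>, of "s - t" "1/c"] that by (simp add: left_diff_distrib)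
  qed
  show "uniform_recurrence_exponent \<beta> x = 1"
    unfolding uniform_recurrence_exponent_def D_def[symmetric] powr_power_neg[OF \<beta>0] one_ereal_def
  proof (rule Sup_exponents_eq)
    fix s :: real assume s: "0 \<le> s" "s < 1"
    from eventually_conj[OF small[OF s(2)] eventually_ge_at_top[of "Q 0"]]
    show "\<forall>\<^sub>F N in sequentially. \<exists>n\<ge>1. n \<le> N \<and> D n < \<beta> powr (- (s * real N))"
    proof (rule eventually_mono)
      fix N assume N: "C * \<beta> powr (- (1 * real N)) < \<beta> powr (- (s * real N)) \<and> Q 0 \<le> N"
      then obtain k where k: "Q k \<le> N" "N < Q (Suc k)"
        using strict_mono_bracket[OF Q(1)] by metis
      have "D (Q k) \<le> C * \<beta> powr (- real (Q (Suc k)))" by (rule close)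
      also have "\<dots> \<le> C * \<beta> powr (- (1 * real N))"
        using k pos by (intro mult_left_mono mono) auto
      finally show "\<exists>n\<ge>1. n \<le> N \<and> D n < \<beta> powr (- (s * real N))"
        using N k(1) Qpos[of k] by (intro exI[of _ "Q k"]) auto
    qed
  next
    fix s :: real assume s: "1 < s"
    show "\<not> (\<forall>\<^sub>F N in sequentially. \<exists>n\<ge>1. n \<le> N \<and> D n < \<beta> powr (- (s * real N)))"
    proof
      assume "\<forall>\<^sub>F N in sequentially. \<exists>n\<ge>1. n \<le> N \<and> D n < \<beta> powr (- (s * real N))"
      \<comment> \<open>The gap from \<open>t\<close> to \<open>s\<close> absorbs the constant
        \<open>c\<close>; the gap from 1 to \<open>t\<close> absorbs the difference between
        \<open>N\<close> and \<open>N + 1\<close>.\<close>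
      moreover define t where "t = (1 + s) / 2"
      have t: "t < s" "1 < t" using s by (auto simp: t_def)
      ultimately have "\<forall>\<^sub>F N in sequentially. (\<exists>n\<ge>1. n \<le> N \<and> D n < \<beta> powr (- (s * real N))) \<and>
         \<beta> powr (- (s * real N)) < c * \<beta> powr (- (t * real N)) \<and> 1 / (t - 1) \<le> real N"
        by (intro eventually_conj large)
           (use filterlim_real_sequentially in \<open>auto simp: filterlim_at_top\<close>)
      then obtain N0 where N0: "\<And>N. N \<ge> N0 \<Longrightarrow> (\<exists>n\<ge>1. n \<le> N \<and> D n < \<beta> powr (- (s * real N))) \<and>
         \<beta> powr (- (s * real N)) < c * \<beta> powr (- (t * real N)) \<and> 1 / (t - 1) \<le> real N"
        by (auto simp: eventually_sequentially)
      \<comment> \<open>The last \<open>N\<close> before the next close return is the worst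
        one.\<close>
      define N where "N = Q (Suc N0) - 1"
      have "Suc N0 \<le> Q (Suc N0)" using strict_mono_imp_increasing[OF Q(1)] .
      then have "N \<ge> N0" and N: "Q (Suc N0) = Suc N" by (auto simp: N_def)
      from N0[OF this(1)] obtain n where n: "1 \<le> n" "n \<le> N" "D n < \<beta> powr (- (s * real N))"
        and lt: "\<beta> powr (- (s * real N)) < c * \<beta> powr (- (t * real N))" and big: "1 / (t - 1) \<le> real N"
        by auto
      have "real N + 1 \<le> t * real N" using big t by (simp add: field_simps)
      then have "c * \<beta> powr (- (t * real N)) \<le> c * \<beta> powr (- real (Q (Suc N0)))"
        using pos N by (intro mult_left_mono mono) auto
      also have "\<dots> \<le> D n" using n N by (intro far) auto
      finally show False using n lt by simp
    qed
  qed simp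
  show "recurrence_exponent \<beta> x = ereal r"
    unfolding recurrence_exponent_def D_def[symmetric] powr_power_neg[OF \<beta>0]
  proof (rule Sup_exponents_eq[OF \<open>0 < r\<close>])
    fix s :: real assume s: "0 \<le> s" "s < r"
    define t where "t = (s + r) / 2"
    have t: "s < t" "t < r" using s by (auto simp: t_def)
    have ev: "\<forall>\<^sub>F k in sequentially. C * \<beta> powr (- (t * real (Q k))) < \<beta> powr (- (s * real (Q k)))"
      using small[OF t(1)] filterlim_subseq[OF Q(1)] by (rule eventually_compose_filterlim)
    have "\<exists>\<^sub>F k in sequentially. D (Q k) < \<beta> powr (- (s * real (Q k)))"
      using frequently_eventually_frequently[OF lower[OF t(2)] ev]
    proof (rule frequently_elim1)
      fix k assume k: "t * real (Q k) \<le> real (Q (Suc k)) \<and>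
        C * \<beta> powr (- (t * real (Q k))) < \<beta> powr (- (s * real (Q k)))"
      have "D (Q k) \<le> C * \<beta> powr (- real (Q (Suc k)))" by (rule close)
      also have "\<dots> \<le> C * \<beta> powr (- (t * real (Q k)))"
        using k pos by (intro mult_left_mono mono) auto
      finally show "D (Q k) < \<beta> powr (- (s * real (Q k)))" using k by simp
    qed
    then have "infinite {k. D (Q k) < \<beta> powr (- (s * real (Q k)))}"
      by (simp add: frequently_cofinite cofinite_eq_sequentially[symmetric])
    then have "infinite (Q ` {k. D (Q k) < \<beta> powr (- (s * real (Q k)))})"
      using strict_mono_imp_inj_on[OF Q(1)] by (simp add: finite_image_iff inj_on_subset)
    then show "infinite {n. 1 \<le> n \<and> D n < \<beta> powr (- (s * real n))}"
      by (rule infinite_super[rotated]) (use Qpos in \<open>auto simp: Suc_le_eq\<close>)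
  next
    fix s :: real assume s: "r < s"
    define t where "t = (s + r) / 2"
    have t: "r < t" "t < s" "0 \<le> t" using s pos by (auto simp: t_def)
    obtain K where K: "\<And>k. k \<ge> K \<Longrightarrow> real (Q (Suc k)) \<le> t * real (Q k)"
      using upper[OF t(1)] by (auto simp: eventually_sequentially)
    have "\<forall>\<^sub>F n in sequentially. \<not> (1 \<le> n \<and> D n < \<beta> powr (- (s * real n)))"
      using eventually_conj[OF large[OF t(2)] eventually_ge_at_top[of "Q K"]]
    proof (rule eventually_mono)
      fix n assume n: "\<beta> powr (- (s * real n)) < c * \<beta> powr (- (t * real n)) \<and> Q K \<le> n"
      then obtain k where k: "K \<le> k" "Q k \<le> n" "n < Q (Suc k)"
        using strict_mono_bracket[OF Q(1)] by metis
      have "real (Q (Suc k)) \<le> t * real (Q k)" by (rule K[OF k(1)])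
      also have "\<dots> \<le> t * real n" using k t by (intro mult_left_mono) auto
      finally have "c * \<beta> powr (- (t * real n)) \<le> c * \<beta> powr (- real (Q (Suc k)))"
        using pos by (intro mult_left_mono mono) auto
      also have "\<dots> \<le> D n" using k Qpos[of k] by (intro far) auto
      finally show "\<not> (1 \<le> n \<and> D n < \<beta> powr (- (s * real n)))" using n by simp
    qed
    then show "\<not> infinite {n. 1 \<le> n \<and> D n < \<beta> powr (- (s * real n))}"
      by (simp add: eventually_cofinite cofinite_eq_sequentially[symmetric])
  qed
qed

section \<open>Expansions in base \<open>\<beta>\<close>\<close>

text \<open>The argument \<open>n\<close> is a shift of the word, so that on suitable words
  \<open>beta_transform\<close> merely raises \<open>n\<close>.\<close>

definition expansion :: "real \<Rightarrow> (nat \<Rightarrow> bool) \<Rightarrow> nat \<Rightarrow> real" where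
  "expansion \<beta> w n = (\<Sum>i. of_bool (w (n + i)) * (1 / \<beta>) ^ Suc i)"

lemma expansion_term_sums:
  fixes \<beta> :: real assumes "\<beta> > 1" shows "(\<lambda>i. (1 / \<beta>) ^ Suc i) sums (1 / (\<beta> - 1))"
  using sums_mult[OF geometric_sums[of "1 / \<beta>"], of "1 / \<beta>"] assms by (simp add: field_simps)

lemma summable_expansion:
  fixes \<beta> :: real assumes "\<beta> > 1" shows "summable (\<lambda>i. of_bool (w (n + i)) * (1 / \<beta>) ^ Suc i)"
  by (rule summable_comparison_test'[OF sums_summable[OF expansion_term_sums[OF assms]], where N = 0])
     (use assms in auto)

lemma expansion_nonneg: "\<beta> > 1 \<Longrightarrow> 0 \<le> expansion \<beta> w n"
  unfolding expansion_def by (rule suminf_nonneg[OF summable_expansion]) auto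

lemma expansion_le: "\<beta> > 1 \<Longrightarrow> expansion \<beta> w n \<le> 1 / (\<beta> - 1)"
  unfolding expansion_def sums_unique[OF expansion_term_sums]
  by (rule suminf_le[OF _ summable_expansion sums_summable[OF expansion_term_sums]]) auto

lemma expansion_rec:
  assumes "\<beta> > 1"
  shows "expansion \<beta> w n = (of_bool (w n) + expansion \<beta> w (Suc n)) / \<beta>"
proof -
  have "(\<Sum>i. of_bool (w (n + Suc i)) * (1 / \<beta>) ^ Suc (Suc i)) =
        (1 / \<beta>) * (\<Sum>i. of_bool (w (Suc n + i)) * (1 / \<beta>) ^ Suc i)"
    by (subst suminf_mult[symmetric, OF summable_expansion[OF assms]]) (simp add: mult_ac)
  then show ?thesis
    using suminf_split_head[OF summable_expansion[OF assms, of w n]]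
    by (simp add: expansion_def algebra_simps add_divide_distrib)
qed

lemma expansion_skip_zeros:
  assumes "\<beta> > 1" "\<And>j. j < m \<Longrightarrow> \<not> w (n + j)"
  shows "expansion \<beta> w n = expansion \<beta> w (n + m) / \<beta> ^ m"
  using assms(2) by (induction m) (simp_all add: expansion_rec[OF assms(1), of w "n + _"])

lemma expansion_diff:
  assumes "\<beta> > 1" "\<And>j. j < m \<Longrightarrow> w (n + j) = w (k + j)"
  shows "expansion \<beta> w n - expansion \<beta> w k = (expansion \<beta> w (n + m) - expansion \<beta> w (k + m)) / \<beta> ^ m"
  using assms(2)
proof (induction m)
  case (Suc m)
  then show ?case
    using expansion_rec[OF assms(1), of w "n + m"] expansion_rec[OF assms(1), of w "k + m"]
    by (simp add: diff_divide_distrib add_divide_distrib mult.commute)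
qed simp

text \<open>A leading one contributes 1 / \<beta>; the next \<open>M\<close> digits vanish, and the
  tail after them is bounded by the word of ones only. Leading zeros only decrease the
  value.\<close>

lemma expansion_sparse_le:
  assumes \<beta>: "\<beta> > 1" and sparse: "\<And>i j. w i \<Longrightarrow> 1 \<le> j \<Longrightarrow> j \<le> M \<Longrightarrow> \<not> w (i + j)"
    and \<theta>: "1 / \<beta> + (1 / \<beta>) ^ Suc M / (\<beta> - 1) \<le> \<theta>"
  shows "expansion \<beta> w n \<le> \<theta>"
proof -
  have one: "expansion \<beta> w n \<le> \<theta>" if "w n" for n
  proof -
    have "expansion \<beta> w (Suc n) = expansion \<beta> w (Suc n + M) / \<beta> ^ M"
      using sparse[OF that, of "Suc _"] by (intro expansion_skip_zeros \<beta>) auto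
    also have "\<dots> \<le> 1 / (\<beta> - 1) / \<beta> ^ M"
      using \<beta> by (intro divide_right_mono expansion_le) auto
    finally have "(of_bool (w n) + expansion \<beta> w (Suc n)) / \<beta> \<le> (1 + 1 / (\<beta> - 1) / \<beta> ^ M) / \<beta>"
      using \<beta> by (intro divide_right_mono add_mono) auto
    also have "\<dots> = 1 / \<beta> + (1 / \<beta>) ^ Suc M / (\<beta> - 1)"
      using \<beta> by (simp add: field_simps)
    finally show ?thesis using \<theta> expansion_rec[OF \<beta>, of w n] by simp
  qed
  have "0 \<le> 1 / \<beta>" "0 \<le> (1 / \<beta>) ^ Suc M / (\<beta> - 1)" using \<beta> by auto
  then have \<theta>0: "0 \<le> \<theta>" using \<theta> by linarith
  show ?thesis
  proof (cases "\<exists>j. w (n + j)")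
    case True
    define j where "j = (LEAST j. w (n + j))"
    have j: "w (n + j)" "\<And>i. i < j \<Longrightarrow> \<not> w (n + i)"
      using LeastI_ex[OF True] not_less_Least unfolding j_def by blast+
    have "expansion \<beta> w n = expansion \<beta> w (n + j) / \<beta> ^ j"
      using j by (intro expansion_skip_zeros \<beta>)
    also have "\<dots> \<le> expansion \<beta> w (n + j) / 1"
      using \<beta> expansion_nonneg[OF \<beta>] by (intro divide_left_mono) auto
    finally show ?thesis using one[OF j(1)] by simp
  next
    case False
    then show ?thesis using \<theta>0 by (simp add: expansion_def)
  qed
qed

text \<open>As all shifts lie in [0,1), the integer part of \<beta> times a value is exactly its
  leading digit.\<close>

lemma beta_transform_expansion:
  assumes \<beta>: "\<beta> > 1" and lt: "\<And>n. expansion \<beta> w n < 1"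
  shows "(beta_transform \<beta> ^^ n) (expansion \<beta> w 0) = expansion \<beta> w n"
proof (induction n)
  case (Suc n)
  have "beta_transform \<beta> (expansion \<beta> w n) = frac (of_bool (w n) + expansion \<beta> w (Suc n))"
    using \<beta> expansion_rec[OF \<beta>, of w n] by (simp add: beta_transform_def)
  also have "\<dots> = expansion \<beta> w (Suc n)"
    using lt expansion_nonneg[OF \<beta>] by (simp add: frac_unique_iff)
  finally show ?case using Suc by simp
qed simp

text \<open>Equal values have equal orbits, and two consecutive points of the orbit determine a
  digit by \<open>expansion_rec\<close>.\<close>

lemma inj_expansion:
  assumes \<beta>: "\<beta> > 1" and lt: "\<And>n. expansion \<beta> w n < 1" "\<And>n. expansion \<beta> v n < 1"
    and eq: "expansion \<beta> w 0 = expansion \<beta> v 0"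
  shows "w = v"
proof
  fix n
  have "expansion \<beta> w n = expansion \<beta> v n" for n
    using beta_transform_expansion[OF \<beta> lt(1)] beta_transform_expansion[OF \<beta> lt(2)] eq by metis
  with expansion_rec[OF \<beta>, of w n] expansion_rec[OF \<beta>, of v n] \<beta>
  show "w n = v n" by (metis add_right_cancel of_bool_eq_iff divide_cancel_right not_one_less_zero)
qed

lemma expansion_shift_le:
  assumes \<beta>: "\<beta> > 1" and lt: "\<And>n. expansion \<beta> w n < 1"
    and "\<And>i. i < m \<Longrightarrow> w (n + i) = w i"
  shows "\<bar>expansion \<beta> w n - expansion \<beta> w 0\<bar> \<le> 1 / \<beta> ^ m"
proof -
  have "\<bar>expansion \<beta> w (n + m) - expansion \<beta> w m\<bar> \<le> 1"
    using lt[of "n + m"] lt[of m] expansion_nonneg[OF \<beta>, of w "n + m"] expansion_nonneg[OF \<beta>, of w m]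
    by linarith
  then show ?thesis
    using expansion_diff[OF \<beta>, of m w n 0] assms(3) \<beta>
    by (simp add: abs_divide divide_right_mono)
qed

text \<open>At the first mismatch the digits differ by 1, while the tails, both between 0 and
  \<theta>, compensate at most \<theta>. The common prefix before it only scales the remaining
  gap.\<close>

lemma expansion_shift_ge:
  assumes \<beta>: "\<beta> > 1" and \<theta>: "\<And>n. expansion \<beta> w n \<le> \<theta>" "\<theta> < 1" and "i < m" "w (n + i) \<noteq> w i"
  shows "(1 - \<theta>) / \<beta> ^ m \<le> \<bar>expansion \<beta> w n - expansion \<beta> w 0\<bar>"
proof -
  define j where "j = (LEAST i. w (n + i) \<noteq> w i)"
  have j: "w (n + j) \<noteq> w j" "\<And>i. i < j \<Longrightarrow> w (n + i) = w i"
    using LeastI[of "\<lambda>i. w (n + i) \<noteq> w i" i] assms(5) not_less_Least unfolding j_def by blast+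
  have "j < m" unfolding j_def using Least_le[of "\<lambda>i. w (n + i) \<noteq> w i" i] assms(4,5) by simp
  have "expansion \<beta> w (n + j) - expansion \<beta> w j =
     (of_bool (w (n + j)) - of_bool (w j) + (expansion \<beta> w (Suc (n + j)) - expansion \<beta> w (Suc j))) / \<beta>"
    using expansion_rec[OF \<beta>, of w "n + j"] expansion_rec[OF \<beta>, of w j]
    by (simp add: diff_divide_distrib add_divide_distrib)
  moreover have "1 - \<theta> \<le> \<bar>of_bool (w (n + j)) - of_bool (w j) +
      (expansion \<beta> w (Suc (n + j)) - expansion \<beta> w (Suc j))\<bar>"
    using \<theta>(1)[of "Suc (n + j)"] \<theta>(1)[of "Suc j"] j(1)
      expansion_nonneg[OF \<beta>, of w "Suc (n + j)"] expansion_nonneg[OF \<beta>, of w "Suc j"]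
    by (cases "w j") auto
  ultimately have "(1 - \<theta>) / \<beta> \<le> \<bar>expansion \<beta> w (n + j) - expansion \<beta> w j\<bar>"
    using \<beta> by (simp add: abs_divide divide_right_mono)
  then have "(1 - \<theta>) / \<beta> / \<beta> ^ j \<le> \<bar>expansion \<beta> w (n + j) - expansion \<beta> w j\<bar> / \<beta> ^ j"
    using \<beta> by (intro divide_right_mono) auto
  also have "\<dots> = \<bar>expansion \<beta> w n - expansion \<beta> w 0\<bar>"
    using expansion_diff[OF \<beta>, of j w n 0] j(2) \<beta> by (simp add: abs_divide)
  finally have "(1 - \<theta>) / \<beta> / \<beta> ^ j \<le> \<bar>expansion \<beta> w n - expansion \<beta> w 0\<bar>" .
  moreover have "(1 - \<theta>) / \<beta> ^ m \<le> (1 - \<theta>) / \<beta> ^ Suc j"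
    using \<beta> \<theta>(2) \<open>j < m\<close> by (intro divide_left_mono power_increasing) auto
  ultimately show ?thesis by simp
qed

section \<open>Periods and standard words\<close>

text \<open>Periods of a prefix are the form in which common prefixes of \<open>w\<close> and its
  shifts enter the theorem of Fine and Wilf.\<close>

definition period_upto :: "(nat \<Rightarrow> 'a) \<Rightarrow> nat \<Rightarrow> nat \<Rightarrow> bool" where
  "period_upto w N p \<longleftrightarrow> (\<forall>i. i + p < N \<longrightarrow> w (i + p) = w i)"

lemma period_upto_mono: "period_upto w N p \<Longrightarrow> N' \<le> N \<Longrightarrow> period_upto w N' p"
  by (auto simp: period_upto_def)

text \<open>Subtractive Euclid: if \<open>p \<le> q\<close>, then \<open>q - p\<close> is also a
  period of the same prefix.\<close>

lemma Fine_Wilf: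
  assumes "period_upto w N p" "period_upto w N q" "p + q \<le> N"
  shows "period_upto w N (gcd p q)"
  using assms
proof (induction "p + q" arbitrary: p q rule: less_induct)
  have step: "period_upto w N (gcd p q)"
    if IH: "\<And>p' q'. p' + q' < p + q \<Longrightarrow> period_upto w N p' \<Longrightarrow> period_upto w N q' \<Longrightarrow>
               p' + q' \<le> N \<Longrightarrow> period_upto w N (gcd p' q')"
      and p: "period_upto w N p" and q: "period_upto w N q" and N: "p + q \<le> N" and pq: "0 < p" "p \<le> q"
    for p q
  proof -
    have "period_upto w N (q - p)"
      unfolding period_upto_def
    proof (intro allI impI)
      fix i assume i: "i + (q - p) < N"
      show "w (i + (q - p)) = w i"
      proof (cases "i + q < N")
        case True
        have "w (i + (q - p) + p) = w (i + (q - p))"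
          using p[unfolded period_upto_def, rule_format, of "i + (q - p)"] True pq by simp
        moreover have "w (i + q) = w i" using q True by (auto simp: period_upto_def)
        ultimately show ?thesis using pq by simp
      next
        case False
        \<comment> \<open>Near the end of the prefix there is no room to go forward by
          \<open>q\<close> first; going back by \<open>p\<close> and then forward by
          \<open>q\<close> works since \<open>p + q \<le> N\<close>.\<close>
        then have "p \<le> i" using N by simp
        then have "w (i - p + p) = w (i - p)" "w (i - p + q) = w (i - p)"
          using p[unfolded period_upto_def, rule_format, of "i - p"]
            q[unfolded period_upto_def, rule_format, of "i - p"] i pq by simp_all
        then show ?thesis using \<open>p \<le> i\<close> pq by simp
      qed
    qed
    then have "period_upto w N (gcd p (q - p))" using pq p N by (intro IH) auto
    then show ?thesis using gcd_diff1_nat[OF pq(2)] by (simp add: gcd.commute)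
  qed
  case (less p q)
  consider "p = 0" | "q = 0" | "0 < p" "p \<le> q" | "0 < q" "q \<le> p" by linarith
  then show ?case
  proof cases
    case 3
    then show ?thesis using step less by blast
  next
    case 4
    have "period_upto w N (gcd q p)"
      by (rule step[OF _ less(3) less(2) _ 4]) (use less in \<open>auto simp: add.commute\<close>)
    then show ?thesis by (simp add: gcd.commute)
  qed (use less in auto)
qed

lemma concat_replicate_append_commute:
  "concat (replicate n xs) @ xs = xs @ concat (replicate n xs)"
  by (induction n) auto

lemma nth_prefix: "prefix xs ys \<Longrightarrow> i < length xs \<Longrightarrow> ys ! i = xs ! i"
  by (auto simp: prefix_def nth_append)

text \<open>The second word puts \<open>M\<close> zeros before its one, a gap that concatenation
  preserves; the two initial lengths 1 and \<open>M + 1\<close> are coprime.\<close>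

fun standard_word :: "nat \<Rightarrow> (nat \<Rightarrow> nat) \<Rightarrow> nat \<Rightarrow> bool list" where
  "standard_word M a 0 = [False]"
| "standard_word M a (Suc 0) = replicate M False @ [True]"
| "standard_word M a (Suc (Suc k)) =
     concat (replicate (a k) (standard_word M a (Suc k))) @ standard_word M a k"

locale standard_words =
  fixes M :: nat and a :: "nat \<Rightarrow> nat"
  assumes M: "1 \<le> M" and a: "\<And>k. 2 \<le> a k"
begin

abbreviation s :: "nat \<Rightarrow> bool list" where "s \<equiv> standard_word M a"

definition q :: "nat \<Rightarrow> nat" where "q k = length (s k)"

text \<open>Each \<open>s i\<close> has more than \<open>i\<close> letters and is a prefix of all
  later words, so the diagonal is their common limit.\<close>

definition w :: "nat \<Rightarrow> bool" where "w i = s i ! i"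

lemma q_0: "q 0 = 1" and q_1: "q (Suc 0) = Suc M"
  and q_rec: "q (Suc (Suc k)) = a k * q (Suc k) + q k"
  by (simp_all add: q_def length_concat sum_list_replicate)

lemma q_pos: "0 < q k"
  by (induction k rule: induct_nat_012) (use a[of "_::nat"] in \<open>auto simp: q_0 q_1 q_rec\<close>)

lemma two_q_less: "2 * q (Suc k) < q (Suc (Suc k))"
  using mult_le_mono1[OF a[of k], of "q (Suc k)"] q_pos[of k] unfolding q_rec by linarith

lemma q_less: "q k < q (Suc k)"
  using two_q_less[of "k - 1"] M by (cases k) (auto simp: q_0 q_1)

lemma strict_mono_q: "strict_mono q"
  by (simp add: strict_mono_Suc_iff q_less)

lemma less_q: "k < q k"
proof (induction k)
  case (Suc k)
  then show ?case using q_less[of k] by simp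
qed (simp add: q_0)

lemma coprime_q: "coprime (q k) (q (Suc k))"
proof (induction k)
  case (Suc k)
  then show ?case by (simp add: q_rec coprime_iff_gcd_eq_1 gcd.commute gcd_add_mult)
qed (simp add: q_0)

lemma prefix_s_Suc: "prefix (s k) (s (Suc k))"
proof (cases k)
  case 0
  then show ?thesis using M by (cases M) auto
next
  case (Suc j)
  obtain n where "a j = Suc n" using a[of j] by (cases "a j") auto
  then show ?thesis using Suc by simp
qed

lemma prefix_s: "j \<le> k \<Longrightarrow> prefix (s j) (s k)"
  by (induction k rule: dec_induct) (auto intro: prefix_order.trans prefix_s_Suc)

lemma w_eq: "i < q k \<Longrightarrow> w i = s k ! i"
  using nth_prefix[OF prefix_s, of i k i] nth_prefix[OF prefix_s, of k i i] less_q[of i]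
  by (cases "i \<le> k") (auto simp: w_def q_def)

text \<open>Both products at the next level start with the power \<open>?p\<close> of
  \<open>s (Suc k)\<close>; behind it stand the two products of the previous level, in exchanged
  roles.\<close>

lemma almost_commute:
  "\<exists>z x y. s (Suc k) @ s k = z @ [x, y] \<and> s k @ s (Suc k) = z @ [y, x]"
proof (induction k)
  case 0
  have "[False] @ replicate M False = replicate M False @ [False]"
    by (metis append_Cons append_Nil replicate_append_same)
  then show ?case by (intro exI[of _ "replicate M False"] exI[of _ True] exI[of _ False]) simp
next
  case (Suc k)
  then obtain z x y where *: "s (Suc k) @ s k = z @ [x, y]" "s k @ s (Suc k) = z @ [y, x]"
    by blast
  let ?p = "concat (replicate (a k) (s (Suc k)))"
  have "s (Suc (Suc k)) @ s (Suc k) = (?p @ z) @ [y, x]" using * by simp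
  moreover have "s (Suc k) @ s (Suc (Suc k)) = (s (Suc k) @ ?p) @ s k" by simp
  then have "s (Suc k) @ s (Suc (Suc k)) = (?p @ z) @ [x, y]"
    using * by (simp flip: concat_replicate_append_commute)
  ultimately show ?case by blast
qed

text \<open>By \<open>2 \<le> a k\<close> the limit starts with \<open>s (Suc k)\<close> twice,
  hence with \<open>s (Suc k) @ s k\<close>. Up to the last two letters this equals
  \<open>s k @ s (Suc k)\<close>, where the part behind \<open>s k\<close> is again a prefix of the
  limit.\<close>

lemma period_q: "period_upto w (q k + q (Suc k) - 2) (q k)"
  unfolding period_upto_def
proof (intro allI impI)
  fix i assume i: "i + q k < q k + q (Suc k) - 2"
  obtain z x y where z: "s (Suc k) @ s k = z @ [x, y]" "s k @ s (Suc k) = z @ [y, x]"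
    using almost_commute by blast
  have "length z + 2 = q k + q (Suc k)" using arg_cong[OF z(2), of length] by (simp add: q_def)
  then have iz: "i + q k < length z" using i by simp
  obtain n where n: "a k = Suc (Suc n)" using a[of k] by (metis Suc_le_D numeral_2_eq_2 Suc_le_mono)
  obtain u where "s (Suc k) = s k @ u" using prefix_s_Suc[of k] by (auto simp: prefix_def)
  then have "s (Suc (Suc k)) = (s (Suc k) @ s k) @ u @ concat (replicate n (s (Suc k))) @ s k"
    using n by simp
  then have "prefix (s (Suc k) @ s k) (s (Suc (Suc k)))" by (rule prefixI)
  then have "prefix z (s (Suc (Suc k)))" unfolding z(1) by (rule append_prefixD)
  then have "w (i + q k) = z ! (i + q k)"
    using iz nth_prefix[of z "s (Suc (Suc k))"] prefix_length_le[of z "s (Suc (Suc k))"]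
    by (subst w_eq[of _ "Suc (Suc k)"]) (auto simp: q_def)
  also have "\<dots> = (s k @ s (Suc k)) ! (i + q k)" unfolding z(2) using iz by (simp add: nth_append)
  also have "\<dots> = s (Suc k) ! i" by (simp add: nth_append q_def)
  also have "\<dots> = w i" using i by (subst w_eq[of i "Suc k"]) auto
  finally show "w (i + q k) = w i" .
qed

text \<open>Otherwise the prefix of length \<open>q (Suc k) + n\<close> has periods \<open>n\<close>
  and \<open>q (Suc k)\<close>, hence their gcd, a proper divisor of \<open>q (Suc k)\<close>. This
  gcd is coprime to \<open>q k\<close>, so Fine and Wilf applied once more gives period 1 on a
  prefix containing the indices 0 and \<open>M\<close>, where the letters differ.\<close>

lemma mismatch:
  assumes k: "1 \<le> k" and n: "1 \<le> n" "n < q (Suc k)"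
  shows "\<exists>i<q (Suc k). w (n + i) \<noteq> w i"
proof (rule ccontr)
  assume "\<not> ?thesis"
  then have pn: "period_upto w (q (Suc k) + n) n"
    by (auto simp: period_upto_def add.commute)
  obtain j where j: "k = Suc j" using k by (cases k) auto
  have two: "2 * q k < q (Suc k)" using two_q_less[of j] j by simp
  have q2: "2 \<le> q k" using less_q[of k] k by simp
  have "period_upto w (q (Suc k) + n) (q (Suc k))"
    using period_q[of "Suc k"] by (rule period_upto_mono) (use n two_q_less[of k] in simp)
  then have pg: "period_upto w (q (Suc k) + n) (gcd n (q (Suc k)))" (is "period_upto _ _ ?g")
    using pn by (intro Fine_Wilf) auto
  have "?g dvd q (Suc k)" by simp
  then obtain m where m: "q (Suc k) = ?g * m" by blast
  have gn: "?g \<le> n" using n by (intro gcd_le1_nat) auto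
  have "m \<noteq> 1" using m n gn by (intro notI) simp
  moreover have "m \<noteq> 0" using m q_pos[of "Suc k"] by (intro notI) simp
  ultimately have "2 \<le> m" by simp
  then have "?g * 2 \<le> ?g * m" by (rule mult_le_mono2)
  then have g: "2 * ?g \<le> q (Suc k)" unfolding m[symmetric] by simp
  \<comment> \<open>\<open>period_q\<close> reaches this far because the gcd is at most half of
    \<open>q (Suc k)\<close>, which pays for the two missing letters.\<close>
  have "period_upto w (?g + q k) (gcd ?g (q k))"
    using Fine_Wilf[of w "?g + q k" ?g "q k"] period_upto_mono[OF pg, of "?g + q k"]
      period_upto_mono[OF period_q, of "?g + q k" k] g two q2 n
    by auto
  moreover have "gcd ?g (q k) = 1"
    using coprime_q[of k] by (metis gcd.commute coprime_iff_gcd_eq_1 gcd.assoc gcd_1_nat gcd.left_commute One_nat_def)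
  ultimately have p1: "period_upto w (?g + q k) 1" by simp
  have "0 < ?g" using n by simp
  then have const: "w i = w 0" if "i \<le> q k" for i
    using that
  proof (induction i)
    case (Suc i)
    have "w (i + 1) = w i"
      using p1[unfolded period_upto_def, rule_format, of i] Suc.prems \<open>0 < ?g\<close> by linarith
    then show ?case using Suc by simp
  qed simp
  have "q (Suc 0) \<le> q k" using strict_mono_q k by (simp add: strict_mono_less_eq)
  then have "w M = w 0" by (intro const) (simp add: q_1)
  moreover have "w M" "\<not> w 0"
    using w_eq[of M "Suc 0"] w_eq[of 0 "0"] by (auto simp: q_1 q_0 nth_append)
  ultimately show False by simp
qed

text \<open>Requiring the \<open>M\<close> zeros before each one to lie inside the word itself makes
  the property stable under concatenation.\<close>

lemma sparse_s:
  "i < q k \<Longrightarrow> s k ! i \<Longrightarrow> M \<le> i \<and> (\<forall>j. 1 \<le> j \<longrightarrow> j \<le> M \<longrightarrow> \<not> s k ! (i - j))"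
proof -
  define P where "P l \<longleftrightarrow> (\<forall>i<length l. l ! i \<longrightarrow> M \<le> i \<and> (\<forall>j. 1 \<le> j \<longrightarrow> j \<le> M \<longrightarrow> \<not> l ! (i - j)))"
    for l :: "bool list"
  have app: "P (l @ l')" if "P l" "P l'" for l l'
    unfolding P_def
  proof (intro allI impI)
    fix i assume i: "i < length (l @ l')" "(l @ l') ! i"
    show "M \<le> i \<and> (\<forall>j. 1 \<le> j \<longrightarrow> j \<le> M \<longrightarrow> \<not> (l @ l') ! (i - j))"
    proof (cases "i < length l")
      case True
      then show ?thesis using that(1) i by (auto simp: P_def nth_append)
    next
      case False
      define i' where "i' = i - length l"
      have i': "i = length l + i'" "i' < length l'" "l' ! i'"
        using i False by (auto simp: i'_def nth_append)
      then have "M \<le> i'" "\<And>j. 1 \<le> j \<Longrightarrow> j \<le> M \<Longrightarrow> \<not> l' ! (i' - j)"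
        using that(2) by (auto simp: P_def)
      then show ?thesis using i'(1) by (auto simp: nth_append)
    qed
  qed
  have rep: "P (concat (replicate n l))" if "P l" for n l
    using that by (induction n) (auto intro: app simp: P_def[of "[]"])
  have "P (s k)"
    by (induction k rule: induct_nat_012)
       (auto intro: app rep, auto simp: P_def nth_append nth_Cons' split: if_splits)
  then show "i < q k \<Longrightarrow> s k ! i \<Longrightarrow> ?thesis" by (simp add: P_def q_def)
qed

lemma sparse_w:
  assumes "w i" "1 \<le> j" "j \<le> M"
  shows "\<not> w (i + j)"
proof
  assume "w (i + j)"
  moreover have "i + j < q (i + j)" by (rule less_q)
  ultimately show False
    using sparse_s[of "i + j" "i + j"] assms w_eq[of "i + j" "i + j"] w_eq[of i "i + j"] by auto
qed

end

section \<open>Recovering the exponents from the limit word\<close>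

text \<open>A larger \<open>b k\<close> would let the shift by \<open>q (Suc k)\<close> agree for at
  least \<open>q (Suc k) - 2\<close> letters beyond the length within which \<open>a\<close> forces
  a mismatch.\<close>

lemma standard_words_exponent_le:
  assumes A: "standard_words M a" and B: "standard_words M b"
    and eq: "standard_words.w M a = standard_words.w M b"
    and q: "standard_words.q M a k = standard_words.q M b k"
      "standard_words.q M a (Suc k) = standard_words.q M b (Suc k)"
  shows "b k \<le> a k"
proof (rule ccontr)
  interpret A: standard_words M a by fact
  interpret B: standard_words M b by fact
  assume "\<not> ?thesis"
  then have "Suc (a k) * A.q (Suc k) \<le> b k * A.q (Suc k)" by (intro mult_right_mono) auto
  then have "A.q (Suc (Suc k)) + A.q (Suc k) \<le> B.q (Suc (Suc k))"
    using q by (simp add: A.q_rec B.q_rec)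
  moreover have "2 \<le> A.q (Suc k)" using A.less_q[of "Suc k"] by simp
  moreover obtain i where "i < A.q (Suc (Suc k))" "A.w (A.q (Suc k) + i) \<noteq> A.w i"
    using A.mismatch[of "Suc k" "A.q (Suc k)"] A.q_pos A.q_less by (auto simp: Suc_le_eq)
  ultimately show False
    using B.period_q[of "Suc k"] eq q by (auto simp: period_upto_def add.commute)
qed

lemma standard_words_inj:
  assumes A: "standard_words M a" and B: "standard_words M b"
    and eq: "standard_words.w M a = standard_words.w M b"
  shows "a = b"
proof -
  interpret A: standard_words M a by fact
  interpret B: standard_words M b by fact
  note le = standard_words_exponent_le[OF A B eq] standard_words_exponent_le[OF B A eq[symmetric]]
  have "A.q k = B.q k \<and> A.q (Suc k) = B.q (Suc k)" for k
  proof (induction k)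
    case (Suc k)
    then have "a k = b k" using le by (metis le_antisym)
    then show ?case using Suc by (simp add: A.q_rec B.q_rec)
  qed (simp add: A.q_0 A.q_1 B.q_0 B.q_1)
  then show ?thesis using le by (metis le_antisym ext)
qed

section \<open>Continued fractions with bounded digits\<close>

text \<open>The value 2 for the cut-off tail keeps all truncations at least 2, where
  \<open>recip_diff_le\<close> applies.\<close>

primrec cfrac :: "nat \<Rightarrow> (nat \<Rightarrow> nat) \<Rightarrow> real" where
  "cfrac 0 e = 2"
| "cfrac (Suc m) e = real (e 0) + 1 / cfrac m (\<lambda>i. e (Suc i))"

text \<open>This contraction serves twice: truncations converge, and ratios of consecutive lengths
  forget their starting value.\<close>

lemma recip_diff_le:
  fixes u v :: real assumes "2 \<le> u" "2 \<le> v"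
  shows "\<bar>1 / u - 1 / v\<bar> \<le> \<bar>u - v\<bar> / 4"
proof -
  have "4 \<le> u * v" using mult_mono[OF assms] assms by simp
  then have "\<bar>u - v\<bar> / (u * v) \<le> \<bar>u - v\<bar> / 4" by (intro divide_left_mono) auto
  moreover have "1 / u - 1 / v = (v - u) / (u * v)" using assms by (simp add: field_simps)
  ultimately show ?thesis using assms by (simp add: abs_divide abs_minus_commute abs_mult)
qed

lemma cfrac_ge: "(\<And>i. 2 \<le> e i) \<Longrightarrow> 2 \<le> cfrac m e"
proof (induction m arbitrary: e)
  case (Suc m)
  have "0 \<le> 1 / cfrac m (\<lambda>i. e (Suc i))" using Suc.IH[of "\<lambda>i. e (Suc i)"] Suc.prems by simp
  moreover have "2 \<le> real (e 0)" using Suc.prems[of 0] by simp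
  ultimately show ?case unfolding cfrac.simps by linarith
qed simp

lemma cfrac_Suc_diff:
  "(\<And>i. 2 \<le> e i) \<Longrightarrow> \<bar>cfrac (Suc m) e - cfrac m e\<bar> \<le> \<bar>cfrac 1 (\<lambda>i. e (m + i)) - 2\<bar> / 4 ^ m"
proof (induction m arbitrary: e)
  case (Suc m)
  let ?e = "\<lambda>i. e (Suc i)"
  have ge: "2 \<le> cfrac m ?e" for m using Suc.prems by (intro cfrac_ge) auto
  have "\<bar>cfrac (Suc (Suc m)) e - cfrac (Suc m) e\<bar> = \<bar>1 / cfrac (Suc m) ?e - 1 / cfrac m ?e\<bar>"
    by simp
  also have "\<dots> \<le> \<bar>cfrac (Suc m) ?e - cfrac m ?e\<bar> / 4" by (intro recip_diff_le ge)
  also have "\<dots> \<le> \<bar>cfrac 1 (\<lambda>i. ?e (m + i)) - 2\<bar> / 4 ^ m / 4"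
    using Suc.IH[of ?e] Suc.prems by (intro divide_right_mono) auto
  finally show ?case by (simp add: mult.commute)
qed simp

lemma convergent_cfrac:
  assumes "\<And>i. 2 \<le> e i" "\<And>i. e i \<le> b"
  shows "convergent (\<lambda>m. cfrac m e)"
proof -
  have "norm (cfrac (Suc m) e - cfrac m e) \<le> real b * (1 / 4) ^ m" for m
  proof -
    have "\<bar>cfrac 1 (\<lambda>i. e (m + i)) - 2\<bar> \<le> real b" using assms[of m] by simp
    then have "\<bar>cfrac 1 (\<lambda>i. e (m + i)) - 2\<bar> / 4 ^ m \<le> real b / 4 ^ m" by (intro divide_right_mono) auto
    then show ?thesis using cfrac_Suc_diff[of e m] assms(1) by (simp add: power_one_over)
  qed
  then have "summable (\<lambda>m. cfrac (Suc m) e - cfrac m e)"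
    by (intro summable_comparison_test'[OF summable_mult[OF summable_geometric], where N = 0]) auto
  then have "convergent (\<lambda>m. cfrac m e - cfrac 0 e)"
    unfolding summable_iff_convergent sum_lessThan_telescope[of "\<lambda>m. cfrac m e"] .
  then show ?thesis by (simp add: convergent_diff_const_right_iff)
qed

definition cf :: "(nat \<Rightarrow> nat) \<Rightarrow> real" where
  "cf e = lim (\<lambda>m. cfrac m e)"

lemma cf_props:
  assumes "\<And>i. 2 \<le> e i" "\<And>i. e i \<le> b"
  shows cf_ge: "2 \<le> cf e" and cf_rec: "cf e = real (e 0) + 1 / cf (\<lambda>i. e (Suc i))"
proof -
  have lim: "(\<lambda>m. cfrac m e) \<longlonglongrightarrow> cf e" if "\<And>i. 2 \<le> e i" "\<And>i. e i \<le> b" for e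
    using convergent_cfrac[OF that] by (simp add: cf_def convergent_LIMSEQ_iff)
  have ge: "2 \<le> cf e" if "\<And>i. 2 \<le> e i" "\<And>i. e i \<le> b" for e
    using that by (intro LIMSEQ_le_const[OF lim[OF that]] exI allI impI cfrac_ge)
  show "2 \<le> cf e" by (rule ge) (use assms in auto)
  let ?e = "\<lambda>i. e (Suc i)"
  have "(\<lambda>m. real (e 0) + 1 / cfrac m ?e) \<longlonglongrightarrow> real (e 0) + 1 / cf ?e"
    using assms ge[of ?e] by (intro tendsto_intros lim) auto
  moreover have "(\<lambda>m. cfrac (Suc m) e) \<longlonglongrightarrow> cf e"
    using lim[OF assms] by (rule LIMSEQ_Suc)
  ultimately show "cf e = real (e 0) + 1 / cf ?e"
    by (auto intro: LIMSEQ_unique)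
qed

lemma cf_inj:
  assumes e: "\<And>i. 2 \<le> e i" "\<And>i. e i \<le> b" and f: "\<And>i. 2 \<le> f i" "\<And>i. f i \<le> b"
    and eq: "cf e = cf f"
  shows "e = f"
proof
  \<comment> \<open>the digits are read off by the Gauss map\<close>
  have *: "\<lfloor>cf g\<rfloor> = int (g 0) \<and> cf (\<lambda>i. g (Suc i)) = 1 / frac (cf g)"
    if "\<And>i. 2 \<le> g i" "\<And>i. g i \<le> b" for g
  proof -
    have "2 \<le> cf (\<lambda>i. g (Suc i))" using that by (intro cf_ge) auto
    then have *: "0 < 1 / cf (\<lambda>i. g (Suc i))" "1 / cf (\<lambda>i. g (Suc i)) < 1" by auto
    have rec: "cf g = real (g 0) + 1 / cf (\<lambda>i. g (Suc i))" by (rule cf_rec[OF that])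
    have "\<lfloor>cf g\<rfloor> = int (g 0)" unfolding rec using * by (intro floor_unique) auto
    then show ?thesis by (simp add: frac_def rec)
  qed
  fix n
  have "cf (\<lambda>i. e (n + i)) = cf (\<lambda>i. f (n + i))"
  proof (induction n)
    case (Suc n)
    then show ?case using *[of "\<lambda>i. e (n + i)"] *[of "\<lambda>i. f (n + i)"] e f by simp
  qed (use eq in simp)
  then show "e n = f n" using *[of "\<lambda>i. e (n + i)"] *[of "\<lambda>i. f (n + i)"] e f by simp
qed

section \<open>The exponents\<close>

definition digit :: "nat set \<Rightarrow> nat \<Rightarrow> nat" where
  "digit C n = (if n \<in> C then 3 else 2)"

text \<open>The leading 4, larger than all later digits, makes the ends of the blocks the places of
  the largest ratios.\<close>

definition target :: "nat set \<Rightarrow> nat \<Rightarrow> nat" where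
  "target C n = (case n of 0 \<Rightarrow> 4 | Suc i \<Rightarrow> digit C i)"

text \<open>Under \<^const>\<open>prod_encode\<close> the antidiagonal \<open>m + n = N\<close> is a block of consecutive indices, with \<open>n\<close>
  running from \<open>N\<close> down to 0: it carries the free separator at \<open>m = 0\<close>, and then the digits of the
  target in reverse order, which is the order in which \<open>q\<^sub>k\<^sub>+\<^sub>1 / q\<^sub>k\<close> reads them.\<close>
definition exponent_seq :: "nat set \<Rightarrow> nat set \<Rightarrow> nat \<Rightarrow> nat" where
  "exponent_seq C D k = (case prod_decode k of (m, n) \<Rightarrow>
     if m = 0 \<and> 0 < n then digit D (n - 1) else target C n)"

lemma target_bounds: "2 \<le> target C n" "target C n \<le> 4"
  by (auto simp: target_def digit_def split: nat.split)

lemma exponent_seq_bounds: "2 \<le> exponent_seq C D k" "exponent_seq C D k \<le> 4"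
  by (simp_all add: exponent_seq_def digit_def target_bounds split: prod.split)

lemma inj_target: "cf (target C) = cf (target C') \<Longrightarrow> C = C'"
proof -
  assume "cf (target C) = cf (target C')"
  then have eq: "target C = target C'"
    by (intro cf_inj[of "target C" 4 "target C'"] target_bounds)
  have "n \<in> C \<longleftrightarrow> n \<in> C'" for n
    using fun_cong[OF eq, of "Suc n"] by (auto simp: target_def digit_def split: if_splits)
  then show ?thesis by blast
qed

lemma inj_exponent_seq:
  assumes "exponent_seq C D = exponent_seq C D'"
  shows "D = D'"
proof -
  have "n \<in> D \<longleftrightarrow> n \<in> D'" for n
    using fun_cong[OF assms, of "prod_encode (0, Suc n)"]
    by (auto simp: exponent_seq_def digit_def split: if_splits)
  then show ?thesis by auto
qed

section \<open>The upper limit of the ratios of consecutive lengths\<close>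

context
  fixes C D :: "nat set" and \<rho> :: "nat \<Rightarrow> real"
  assumes \<rho>_0: "2 \<le> \<rho> 0" "\<rho> 0 \<le> 5"
    and \<rho>_Suc: "\<And>k. \<rho> (Suc k) = real (exponent_seq C D (Suc k)) + 1 / \<rho> k"
begin

lemma ratio_ge: "2 \<le> \<rho> k"
proof (induction k)
  case (Suc k)
  have "real 2 \<le> real (exponent_seq C D (Suc k))" using exponent_seq_bounds by (intro of_nat_mono)
  moreover have "0 \<le> 1 / \<rho> k" using Suc by simp
  ultimately show ?case unfolding \<rho>_Suc by linarith
qed (rule \<rho>_0)

lemma ratio_le: "\<rho> (Suc k) \<le> real (exponent_seq C D (Suc k)) + 1 / 2"
  using ratio_ge[of k] by (simp add: \<rho>_Suc field_simps)

lemma ratio_le_5: "\<rho> k \<le> 5"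
proof (cases k)
  case (Suc j)
  have "real (exponent_seq C D (Suc j)) \<le> real 4" using exponent_seq_bounds by (intro of_nat_mono)
  then show ?thesis using ratio_le[of j] Suc by simp
qed (simp add: \<rho>_0)

text \<open>A step along an antidiagonal raises the code by one, so the recursion for \<rho> leads
  from \<open>(m, Suc n)\<close> to \<open>(Suc m, n)\<close>.\<close>

lemma prod_encode_Suc: "prod_encode (Suc m, n) = Suc (prod_encode (m, Suc n))"
  by (simp add: prod_encode_def)

text \<open>Each step in a block applies the same map \<open>target C n + 1 / _\<close> to both
  numbers and divides the error by at least 4. At the start \<open>m = 0\<close> only the bounds 2
  and 5 are used.\<close>

lemma ratio_near_cf: "\<bar>\<rho> (prod_encode (m, n)) - cf (\<lambda>i. target C (n + i))\<bar> \<le> 5 / 4 ^ m"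
proof (induction m arbitrary: n)
  case 0
  let ?e = "\<lambda>i. target C (n + i)"
  have "cf ?e = real (target C n) + 1 / cf (\<lambda>i. ?e (Suc i))"
    using cf_rec[of ?e 4] target_bounds by simp
  moreover have "2 \<le> cf (\<lambda>i. ?e (Suc i))" using target_bounds by (intro cf_ge)
  then have "1 / cf (\<lambda>i. ?e (Suc i)) \<le> 1" by simp
  moreover have "real (target C n) \<le> real 4" using target_bounds by (intro of_nat_mono)
  ultimately have "cf ?e \<le> 5" by simp
  moreover have "2 \<le> cf ?e" using target_bounds by (intro cf_ge)
  ultimately have "\<bar>\<rho> (prod_encode (0, n)) - cf ?e\<bar> \<le> 5"
    using ratio_ge[of "prod_encode (0, n)"] ratio_le_5[of "prod_encode (0, n)"] by simp
  then show ?case by simp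
next
  case (Suc m)
  let ?e = "\<lambda>i. target C (n + i)" and ?k = "prod_encode (m, Suc n)"
  have "cf ?e = real (target C n) + 1 / cf (\<lambda>i. target C (Suc n + i))"
    using cf_rec[of ?e 4] target_bounds by simp
  moreover have "\<rho> (prod_encode (Suc m, n)) = real (target C n) + 1 / \<rho> ?k"
    unfolding prod_encode_Suc \<rho>_Suc
    unfolding prod_encode_Suc[symmetric] by (simp add: exponent_seq_def)
  ultimately have "\<bar>\<rho> (prod_encode (Suc m, n)) - cf ?e\<bar> = \<bar>1 / \<rho> ?k - 1 / cf (\<lambda>i. target C (Suc n + i))\<bar>"
    by simp
  also have "\<dots> \<le> \<bar>\<rho> ?k - cf (\<lambda>i. target C (Suc n + i))\<bar> / 4"
    using target_bounds by (intro recip_diff_le ratio_ge cf_ge)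
  also have "\<dots> \<le> 5 / 4 ^ m / 4"
    by (intro divide_right_mono Suc) auto
  finally show ?case by (simp add: mult.commute)
qed

lemma ratio_tendsto: "(\<lambda>m. \<rho> (prod_encode (m, 0))) \<longlonglongrightarrow> cf (target C)"
proof (rule LIM_zero_cancel, rule Lim_null_comparison)
  show "\<forall>\<^sub>F m in sequentially. norm (\<rho> (prod_encode (m, 0)) - cf (target C)) \<le> 5 * (1 / 4) ^ m"
    using ratio_near_cf[of _ 0] by (intro always_eventually) (simp add: power_one_over)
  show "(\<lambda>m. 5 * (1 / 4) ^ m :: real) \<longlonglongrightarrow> 0"
    by (intro tendsto_mult_right_zero LIMSEQ_power_zero) auto
qed

lemma ratio_frequently: "t < cf (target C) \<Longrightarrow> \<exists>\<^sub>F k in sequentially. t \<le> \<rho> k"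
proof -
  assume "t < cf (target C)"
  then have "\<forall>\<^sub>F m in sequentially. t < \<rho> (prod_encode (m, 0))"
    using ratio_tendsto by (rule order_tendstoD(1)[rotated])
  then obtain m0 where m0: "\<And>m. m \<ge> m0 \<Longrightarrow> t < \<rho> (prod_encode (m, 0))"
    by (auto simp: eventually_sequentially)
  have "\<exists>k\<ge>K. t \<le> \<rho> k" for K
    using m0[of "max m0 K"] le_prod_encode_1[of "max m0 K" 0]
    by (intro exI[of _ "prod_encode (max m0 K, 0)"]) auto
  then show ?thesis by (simp add: frequently_sequentially)
qed

text \<open>At the block ends \<open>n = 0\<close> the ratios converge. Elsewhere the digit is at
  most 3 and the ratio at most 3 + 1/2, below \<open>cf (target C)\<close>, which is at least
  4.\<close>

lemma ratio_eventually: "cf (target C) < t \<Longrightarrow> \<forall>\<^sub>F k in sequentially. \<rho> k \<le> t"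
proof -
  assume t: "cf (target C) < t"
  then have "\<forall>\<^sub>F m in sequentially. \<rho> (prod_encode (m, 0)) < t"
    using ratio_tendsto by (rule order_tendstoD(2)[rotated])
  then obtain m0 where m0: "\<And>m. m \<ge> m0 \<Longrightarrow> \<rho> (prod_encode (m, 0)) < t"
    by (auto simp: eventually_sequentially)
  have four: "4 \<le> cf (target C)"
  proof -
    have "0 \<le> 1 / cf (\<lambda>i. target C (Suc i))"
      using cf_ge[of "\<lambda>i. target C (Suc i)" 4] target_bounds by simp
    moreover have "cf (target C) = real (target C 0) + 1 / cf (\<lambda>i. target C (Suc i))"
      using target_bounds by (intro cf_rec)
    ultimately show ?thesis by (simp add: target_def)
  qed
  \<comment> \<open>Index 0 is exempt because \<open>ratio_le\<close> speaks of successors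
    only.\<close>
  have "\<rho> k \<le> t" if k: "k \<notin> insert 0 ((\<lambda>m. prod_encode (m, 0)) ` {..<m0})" for k
  proof -
    obtain m n where mn: "k = prod_encode (m, n)" by (metis prod_decode_inverse surj_pair)
    obtain j where j: "k = Suc j" using k by (cases k) auto
    show ?thesis
    proof (cases "n = 0")
      case True
      then have "m0 \<le> m" using k mn by (auto simp: not_less[symmetric])
      from m0[OF this] show ?thesis using mn True by simp
    next
      case False
      then have "real (exponent_seq C D (Suc j)) \<le> real 3"
        using mn unfolding j[symmetric] of_nat_le_iff
        by (auto simp: exponent_seq_def digit_def target_def split: nat.split)
      then show ?thesis using ratio_le[of j] four t j by simp
    qed
  qed
  then have "{k. \<not> \<rho> k \<le> t} \<subseteq> insert 0 ((\<lambda>m. prod_encode (m, 0)) ` {..<m0})" by blast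
  then show ?thesis
    by (simp add: cofinite_eq_sequentially[symmetric] eventually_cofinite finite_subset)
qed

end

section \<open>Uncountability and assembly\<close>

lemma uncountable_nat_sets: "uncountable (UNIV :: nat set set)"
proof
  assume "countable (UNIV :: nat set set)"
  then have "range (from_nat_into (UNIV :: nat set set)) = UNIV" by (intro range_from_nat_into) auto
  then show False using Cantors_theorem[of UNIV] by (auto simp: Pow_UNIV)
qed

lemma exponents_standard_word:
  fixes \<beta> :: real
  assumes \<beta>: "\<beta> > 1" and gaps: "1 \<le> M" "1 / \<beta> + (1 / \<beta>) ^ Suc M / (\<beta> - 1) \<le> \<theta>" "\<theta> < 1"
  defines "x \<equiv> \<lambda>a. expansion \<beta> (standard_words.w M a) 0"
  shows "x (exponent_seq C D) \<in> {0..<1}"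
    "uniform_recurrence_exponent \<beta> (x (exponent_seq C D)) = 1"
    "recurrence_exponent \<beta> (x (exponent_seq C D)) = ereal (cf (target C))"
    "x (exponent_seq C D) = x (exponent_seq C D') \<Longrightarrow> D = D'"
proof -
  have words: "standard_words M (exponent_seq C D)" for D
    by unfold_locales (use gaps exponent_seq_bounds in auto)
  have le: "expansion \<beta> (standard_words.w M (exponent_seq C D)) n \<le> \<theta>" for n D
    using standard_words.sparse_w[OF words] by (intro expansion_sparse_le[OF \<beta> _ gaps(2)]) auto
  then have lt: "expansion \<beta> (standard_words.w M (exponent_seq C D)) n < 1" for n D
    using gaps(3) le_less_trans by blast
  show "x (exponent_seq C D) \<in> {0..<1}" using lt expansion_nonneg[OF \<beta>] by (simp add: x_def)
  show "D = D'" if "x (exponent_seq C D) = x (exponent_seq C D')"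
    using that lt unfolding x_def
    by (intro inj_exponent_seq[of C] standard_words_inj[OF words words] inj_expansion[OF \<beta>])
  interpret standard_words M "exponent_seq C D" by (rule words)
  \<comment> \<open>Starting at \<open>q 1\<close> meets the condition \<open>1 \<le> k\<close> of
    \<open>mismatch\<close> and keeps the first ratio in [2, 5], whereas
    \<open>q 1 / q 0 = M + 1\<close> depends on \<open>M\<close>.\<close>
  define Q where "Q k = q (Suc k)" for k
  define \<rho> where "\<rho> k = real (Q (Suc k)) / real (Q k)" for k
  have Q: "strict_mono Q" "0 < Q k" for k
    using q_pos by (simp_all add: Q_def strict_mono_Suc_iff q_less)
  have \<rho>_0: "\<rho> 0 = real (exponent_seq C D 0) + 1 / real (Suc M)"
    by (simp add: \<rho>_def Q_def q_rec q_0 q_1 field_simps)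
  have \<rho>: "2 \<le> \<rho> 0" "\<rho> 0 \<le> 5" "\<rho> (Suc k) = real (exponent_seq C D (Suc k)) + 1 / \<rho> k" for k
  proof -
    have "real 2 \<le> real (exponent_seq C D 0)" "real (exponent_seq C D 0) \<le> real 4"
      using exponent_seq_bounds by (intro of_nat_mono; simp)+
    moreover have "0 \<le> 1 / real (Suc M)" "1 / real (Suc M) \<le> 1" by auto
    ultimately show "2 \<le> \<rho> 0" "\<rho> 0 \<le> 5" unfolding \<rho>_0 by linarith+
    show "\<rho> (Suc k) = real (exponent_seq C D (Suc k)) + 1 / \<rho> k"
    proof -
      have "Q (Suc (Suc k)) = exponent_seq C D (Suc k) * Q (Suc k) + Q k"
        unfolding Q_def by (rule q_rec)
      then show ?thesis using Q(2)[of "Suc k"] by (simp add: \<rho>_def add_divide_distrib)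
    qed
  qed
  have four: "0 < cf (target C)" using cf_ge[of "target C" 4] target_bounds by simp
  have T: "(beta_transform \<beta> ^^ n) (expansion \<beta> w 0) = expansion \<beta> w n" for n
    using lt by (intro beta_transform_expansion \<beta>)
  have p: "\<beta> powr (- real n) = 1 / \<beta> ^ n" for n
    using \<beta> by (simp add: powr_minus powr_realpow field_simps)
  \<comment> \<open>The factor \<open>\<beta>\<^sup>2\<close> pays for the two letters lost in
    \<open>period_q\<close>.\<close>
  have close: "\<bar>expansion \<beta> w (Q k) - expansion \<beta> w 0\<bar> \<le> \<beta>\<^sup>2 * (1 / \<beta> ^ Q (Suc k))" for k
  proof -
    have "2 \<le> Q (Suc k)" using less_q[of "Suc (Suc k)"] by (simp add: Q_def)
    then have "\<beta>\<^sup>2 * (1 / \<beta> ^ Q (Suc k)) = 1 / \<beta> ^ (Q (Suc k) - 2)"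
      using \<beta> by (simp add: power_diff)
    moreover have "\<bar>expansion \<beta> w (Q k) - expansion \<beta> w 0\<bar> \<le> 1 / \<beta> ^ (Q (Suc k) - 2)"
      using period_q[of "Suc k"] lt
      by (intro expansion_shift_le \<beta>) (auto simp: period_upto_def Q_def add.commute)
    ultimately show ?thesis by simp
  qed
  have far: "(1 - \<theta>) * (1 / \<beta> ^ Q (Suc k)) \<le> \<bar>expansion \<beta> w n - expansion \<beta> w 0\<bar>"
    if n: "1 \<le> n" "n < Q (Suc k)" for k n
  proof -
    obtain i where "i < Q (Suc k)" "w (n + i) \<noteq> w i"
      using mismatch[of "Suc k" n] n by (auto simp: Q_def)
    then show ?thesis using expansion_shift_ge[OF \<beta> le gaps(3)] by simp
  qed
  have upper: "\<forall>\<^sub>F k in sequentially. real (Q (Suc k)) \<le> t * real (Q k)" if "cf (target C) < t" for t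
    using ratio_eventually[OF \<rho> that]
    by (rule eventually_mono) (use Q(2) in \<open>simp add: \<rho>_def divide_le_eq\<close>)
  have lower: "\<exists>\<^sub>F k in sequentially. t * real (Q k) \<le> real (Q (Suc k))" if "t < cf (target C)" for t
    using ratio_frequently[OF \<rho> that]
    by (rule frequently_elim1) (use Q(2) in \<open>simp add: \<rho>_def le_divide_eq\<close>)
  have pos: "0 < \<beta>\<^sup>2" "0 < 1 - \<theta>" using \<beta> gaps by auto
  note exponents_of_return_times[OF \<beta> Q(1) Q(2)[of 0] pos four _ _ upper lower,
      where x = "expansion \<beta> w 0", unfolded T p, OF close far]
  then show "uniform_recurrence_exponent \<beta> (x (exponent_seq C D)) = 1"
    "recurrence_exponent \<beta> (x (exponent_seq C D)) = ereal (cf (target C))"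
    by (simp_all add: x_def)
qed

lemma ex_sparseness:
  fixes \<beta> :: real assumes "\<beta> > 1"
  obtains M \<theta> where "1 \<le> M" "1 / \<beta> + (1 / \<beta>) ^ Suc M / (\<beta> - 1) \<le> \<theta>" "\<theta> < 1"
proof -
  \<comment> \<open>The midpoint of 1 / \<beta> and 1 leaves room for the tail, which tends to 0 as
    \<open>M\<close> grows.\<close>
  define \<theta> where "\<theta> = (1 + 1 / \<beta>) / 2"
  have \<theta>: "1 / \<beta> < \<theta>" "\<theta> < 1" using assms by (auto simp: \<theta>_def field_simps)
  then obtain n where n: "(1 / \<beta>) ^ n < (\<theta> - 1 / \<beta>) * (\<beta> - 1)"
    using assms real_arch_pow_inv[of "(\<theta> - 1 / \<beta>) * (\<beta> - 1)" "1 / \<beta>"] by auto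
  \<comment> \<open>The witness is \<open>M = Suc n\<close>, which secures \<open>1 \<le> M\<close>;
    hence the exponent \<open>Suc (Suc n)\<close>.\<close>
  have "(1 / \<beta>) ^ Suc (Suc n) \<le> (1 / \<beta>) ^ n" using assms by (intro power_decreasing) auto
  then have "(1 / \<beta>) ^ Suc (Suc n) / (\<beta> - 1) \<le> \<theta> - 1 / \<beta>"
    using n assms by (simp only: pos_divide_le_eq)
  then show ?thesis using \<theta> by (intro that[of "Suc n" \<theta>]) auto
qed

theorem theorem1p1:
  fixes \<beta> :: real
  assumes "\<beta> > 1"
  shows "\<exists>R :: real set. uncountable R \<and>
    (\<forall>r\<in>R. uncountable {x \<in> {0..<1}.
       uniform_recurrence_exponent \<beta> x = 1 \<and> recurrence_exponent \<beta> x = ereal r})"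
proof -
  obtain M \<theta> where M: "1 \<le> M" "1 / \<beta> + (1 / \<beta>) ^ Suc M / (\<beta> - 1) \<le> \<theta>" "\<theta> < 1"
    using ex_sparseness[OF assms] .
  \<comment> \<open>\<open>C\<close> determines the exponent and, for fixed \<open>C\<close>,
    \<open>D\<close> distinguishes the points; both dependences are injective.\<close>
  define x where "x C D = expansion \<beta> (standard_words.w M (exponent_seq C D)) 0" for C D
  note x = exponents_standard_word[OF assms M, folded x_def]
  have "uncountable {y \<in> {0..<1}. uniform_recurrence_exponent \<beta> y = 1 \<and>
      recurrence_exponent \<beta> y = ereal (cf (target C))}" for C
  proof
    assume "countable {y \<in> {0..<1}. uniform_recurrence_exponent \<beta> y = 1 \<and>
      recurrence_exponent \<beta> y = ereal (cf (target C))}"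
    then have "countable (range (x C))" by (rule countable_subset[rotated]) (use x in auto)
    moreover have "inj (x C)" using x(4) by (auto intro: injI)
    ultimately show False using uncountable_nat_sets countable_image_inj_on by blast
  qed
  moreover have "uncountable (range (\<lambda>C. cf (target C)))"
    using uncountable_nat_sets countable_image_inj_on inj_target by (metis injI)
  ultimately show ?thesis by (intro exI[of _ "range (\<lambda>C. cf (target C))"]) auto
qed

end
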